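(* There exist positive constants $\delta$, $C$ and $N$ such that for all integers $n\ge N$ and all integers $k$ with $1\le k\le n^{3/4}$, the set of $\alpha\in[0,1]$ (irrational) satisfying \[ S(\alpha,n,k)\ge \left(C\log\lfloor n/k\rfloor\right)^k \] has Lebesgue measure at least $1-\exp(-\delta\log^2 n)$.
   Context: Every irrational $\alpha\in(0,1)$ has a unique continued fraction expansion $\alpha = 1/(a_1(\alpha)+1/(a_2(\alpha)+\cdots))$ with digits $a_i(\alpha)\in\mathbb{N}_{\ge1}$. For $1\le k\le n$ integers, \[ S(\alpha,n,k) := \binom{n}{k}^{-1}\sum_{1\le i_1<\cdots<i_k\le n} a_{i_1}(\alpha)\cdots a_{i_k}(\alpha). \] *)

theory Defs
  imports "HOL-Analysis.Analysis"
begin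

definition gauss_map :: "real \<Rightarrow> real" where
  "gauss_map x = frac (1 / x)"

definition cf_digit :: "real \<Rightarrow> nat \<Rightarrow> nat" where
  "cf_digit \<alpha> i = nat \<lfloor>1 / ((gauss_map ^^ (i - 1)) \<alpha>)\<rfloor>"

definition S_cf :: "real \<Rightarrow> nat \<Rightarrow> nat \<Rightarrow> real" where
  "S_cf \<alpha> n k =
     (\<Sum>I\<in>{I. I \<subseteq> {1..n} \<and> card I = k}. \<Prod>i\<in>I. real (cf_digit \<alpha> i)) / real (n choose k)"

end

theory Submission
  imports Defs "HOL-Real_Asymp.Real_Asymp"
begin

text \<open>
  Conditionally on the first digits, the tail variable has a density
  \<open>(1 + s) / (1 + s t)\<^sup>2\<close> on \<open>(0, 1)\<close> with \<open>s \<in> [0, 1]\<close>, so the next digit is at least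
  \<open>j\<close> with probability \<open>(1 + s) / (j + s) \<ge> 1 / j\<close>, whatever the past. Laplace transforms of sums
  of digits truncated at \<open>M\<close> are therefore bounded by products, as for independent variables.

  Split \<open>{1..n}\<close> into \<open>k\<close> blocks of length \<open>m = n div k\<close> and take \<open>M\<close> close to \<open>sqrt m\<close>. By
  Chernoff's bound, outside a set of measure about \<open>k exp (- sqrt m / 4)\<close> every block sum is at
  least \<open>(m ln M) / 4\<close>. Choosing one index in each block, the product of the block sums bounds the
  elementary symmetric sum from below, while \<open>n choose k\<close> is at most \<open>(2 e m) ^ k\<close>.
\<close>

section \<open>Densities stable under conditioning on digits\<close>

definition cf_density :: "real \<Rightarrow> real \<Rightarrow> real" where
  "cf_density s x = (1 + s) / (1 + s * x)\<^sup>2"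

text \<open>At \<open>s = 0\<close> the density is constantly 1, so \<open>cf_measure 0\<close> is
  Lebesgue measure on the open unit interval. The other parameters arise only as conditional
  laws.\<close>

definition cf_measure :: "real \<Rightarrow> real measure" where
  "cf_measure s = density lborel (\<lambda>x. ennreal (cf_density s x) * indicator {0<..<1} x)"

text \<open>
  The branch \<open>u \<mapsto> 1 / (a + u)\<close> with digit \<open>a\<close> has mass \<open>cf_weight s a\<close> under \<open>cf_measure s\<close>, and the
  Gauss map sends the normalized restriction to \<open>cf_measure (1 / (a + s))\<close>: this family of measures
  is closed under conditioning on digits.
\<close>
definition cf_weight :: "real \<Rightarrow> nat \<Rightarrow> real" where
  "cf_weight s a = (1 + s) / ((real a + s) * (real a + s + 1))"

lemma sets_cf_measure [measurable_cong, simp]: "sets (cf_measure s) = sets borel"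
  by (simp add: cf_measure_def)

lemma space_cf_measure [simp]: "space (cf_measure s) = UNIV"
  by (simp add: cf_measure_def)

lemma measurable_cf_density [measurable]: "cf_density s \<in> borel_measurable borel"
  unfolding cf_density_def by measurable

lemma measurable_gauss_map [measurable]: "gauss_map \<in> borel_measurable borel"
  unfolding gauss_map_def frac_def by measurable

lemma measurable_gauss_map_funpow [measurable]: "gauss_map ^^ i \<in> borel_measurable borel"
  by (induction i) (auto intro: measurable_comp[OF _ measurable_gauss_map])

lemma measurable_cf_digit [measurable]: "(\<lambda>x. cf_digit x i) \<in> measurable borel (count_space UNIV)"
  unfolding cf_digit_def by measurable

lemma cf_digit_shift: "cf_digit x (Suc (Suc i)) = cf_digit (gauss_map x) (Suc i)"
  by (simp add: cf_digit_def funpow_swap1)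

lemma nn_integral_cf_measure:
  assumes [measurable]: "G \<in> borel_measurable borel"
  shows "(\<integral>\<^sup>+x. G x \<partial>cf_measure s) =
    (\<integral>\<^sup>+x. G x * ennreal (cf_density s x) * indicator {0<..<1} x \<partial>lborel)"
  unfolding cf_measure_def by (subst nn_integral_density) (auto simp: mult_ac)

lemma emeasure_cf_measure_UNIV:
  assumes "0 \<le> s"
  shows "emeasure (cf_measure s) UNIV = 1"
proof -
  have nz: "1 + s * x \<noteq> 0" if "0 \<le> x" for x
    using mult_nonneg_nonneg[OF assms that] by linarith
  have "emeasure (cf_measure s) UNIV = (\<integral>\<^sup>+x. ennreal (cf_density s x) * indicator {0<..<1} x \<partial>lborel)"
    unfolding cf_measure_def by (subst emeasure_density) auto
  also have "\<dots> = (\<integral>\<^sup>+x. ennreal (cf_density s x) * indicator {0..1} x \<partial>lborel)"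
  proof (rule nn_integral_cong_AE)
    show "AE x in lborel. ennreal (cf_density s x) * indicator {0<..<1} x
        = ennreal (cf_density s x) * indicator {0..1} x"
      using AE_lborel_singleton[of 0] AE_lborel_singleton[of 1]
      by eventually_elim (auto simp: indicator_def)
  qed
  also have "\<dots> = ennreal ((1 + s) * 1 / (1 + s * 1) - (1 + s) * 0 / (1 + s * 0))"
  proof (rule nn_integral_FTC_Icc)
    fix x :: real assume x: "x \<in> {0..1}"
    show "((\<lambda>x. (1 + s) * x / (1 + s * x)) has_real_derivative cf_density s x) (at x)"
      unfolding cf_density_def
      using nz[of x] x by (auto intro!: derivative_eq_intros simp: divide_simps power2_eq_square algebra_simps)
    show "0 \<le> cf_density s x" using assms by (simp add: cf_density_def)
  qed auto
  also have "\<dots> = 1" using assms by simp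
  finally show ?thesis .
qed

section \<open>Transfer along the inverse branches of the Gauss map\<close>

lemma nn_integral_Gauss_branch:
  fixes g :: "real \<Rightarrow> ennreal"
  assumes [measurable]: "g \<in> borel_measurable borel" and "0 < c"
  shows "(\<integral>\<^sup>+x. g x * indicator {1 / (c + 1)..1 / c} x \<partial>lborel) =
    (\<integral>\<^sup>+u. g (1 / (c + u)) * ennreal (1 / (c + u)\<^sup>2) * indicator {0<..<1} u \<partial>lborel)"
proof -
  \<comment> \<open>The branch \<open>1 / (c + u)\<close> decreases in \<open>u\<close>, whereas the
    substitution rule is for increasing maps. The branch is therefore composed with the reflection
    of \<open>u\<close> to \<open>1 - u\<close>, which is undone afterwards.\<close>
  have "(\<integral>\<^sup>+x. g x * indicator {1 / (c + 1 - 0)..1 / (c + 1 - 1)} x \<partial>lborel) =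
    (\<integral>\<^sup>+u. g (1 / (c + 1 - u)) * ennreal (1 / (c + 1 - u)\<^sup>2) * indicator {0..1} u \<partial>lborel)"
  proof (rule nn_integral_substitution_aux)
    fix x :: real assume "x \<in> {0..1}"
    then show "((\<lambda>u. 1 / (c + 1 - u)) has_real_derivative 1 / (c + 1 - x)\<^sup>2) (at x)"
      using assms(2) by (auto intro!: derivative_eq_intros simp: power2_eq_square)
  qed (use assms(2) in \<open>auto intro!: continuous_intros\<close>)
  also have "\<dots> = (\<integral>\<^sup>+u. g (1 / (c + u)) * ennreal (1 / (c + u)\<^sup>2) * indicator {0..1} u \<partial>lborel)"
    by (subst nn_integral_real_affine[where c = "-1" and t = 1])
       (auto intro!: nn_integral_cong simp: indicator_def)
  also have "\<dots> = (\<integral>\<^sup>+u. g (1 / (c + u)) * ennreal (1 / (c + u)\<^sup>2) * indicator {0<..<1} u \<partial>lborel)"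
  proof (rule nn_integral_cong_AE)
    show "AE u in lborel. g (1 / (c + u)) * ennreal (1 / (c + u)\<^sup>2) * indicator {0..1} u
        = g (1 / (c + u)) * ennreal (1 / (c + u)\<^sup>2) * indicator {0<..<1} u"
      using AE_lborel_singleton[of 0] AE_lborel_singleton[of 1]
      by eventually_elim (auto simp: indicator_def)
  qed
  finally show ?thesis by simp
qed

text \<open>Since \<open>1 + s / (a + u) = (a + s + u) / (a + u)\<close>, the Jacobian cancels
  against the squared denominator. What remains is again a density of the family, with parameter
  \<open>1 / (a + s)\<close>, times a factor free of \<open>u\<close>.\<close>

lemma cf_density_branch:
  assumes "0 \<le> s" "0 \<le> u" "1 \<le> a"
  shows "cf_density s (1 / (real a + u)) * (1 / (real a + u)\<^sup>2) =
    cf_weight s a * cf_density (1 / (real a + s)) u"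
proof -
  define b where "b = real a"
  have b: "1 \<le> b" using assms by (simp add: b_def)
  have nz: "b + u \<noteq> 0" "b + s \<noteq> 0" "b + s + u \<noteq> 0" "b + s + 1 \<noteq> 0" using b assms by linarith+
  have 1: "1 + s * (1 / (b + u)) = (b + s + u) / (b + u)" using nz by (simp add: field_simps)
  have 2: "1 + 1 / (b + s) * u = (b + s + u) / (b + s)" using nz by (simp add: field_simps)
  have 3: "1 + 1 / (b + s) = (b + s + 1) / (b + s)" using nz by (simp add: field_simps)
  show ?thesis
    unfolding cf_density_def cf_weight_def b_def[symmetric] 1 2 3 using nz
    by (simp add: power_divide power2_eq_square)
qed

text \<open>First-step decomposition: integrating over the first digit leaves the tail distributed
  according to the updated parameter. Only upper bounds are wanted later, so an inequality suffices.
  This permits closed branch intervals that overlap at endpoints, as long as they cover the unit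
  interval.\<close>

lemma nn_integral_cf_measure_step:
  fixes f :: "nat \<Rightarrow> ennreal"
  assumes [measurable]: "G \<in> borel_measurable borel" and s: "0 \<le> s"
  shows "(\<integral>\<^sup>+x. f (cf_digit x (Suc 0)) * G (gauss_map x) \<partial>cf_measure s) \<le>
    (\<Sum>a. f (Suc a) * ennreal (cf_weight s (Suc a)) * (\<integral>\<^sup>+u. G u \<partial>cf_measure (1 / (real (Suc a) + s))))"
proof -
  define H where "H x = f (cf_digit x (Suc 0)) * G (gauss_map x) * ennreal (cf_density s x)" for x
  have [measurable]: "H \<in> borel_measurable borel" unfolding H_def by measurable
  have cover: "\<exists>a. x \<in> {1 / (real (Suc a) + 1)..1 / real (Suc a)}" if "0 < x" "x < 1" for x
  proof -
    have "1 \<le> \<lfloor>1 / x\<rfloor>" using that by simp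
    then obtain a where a: "\<lfloor>1 / x\<rfloor> = int (Suc a)"
      by (metis Suc_le_D nat_int_comparison(3) of_nat_1 zero_less_one_class.zero_le_one One_nat_def nonneg_int_cases order_trans)
    have "real (Suc a) \<le> 1 / x" "1 / x \<le> real (Suc a) + 1" using a by linarith+
    then show ?thesis using that by (intro exI[of _ a]) (auto simp: field_simps)
  qed
  have "(\<integral>\<^sup>+x. f (cf_digit x (Suc 0)) * G (gauss_map x) \<partial>cf_measure s)
      = (\<integral>\<^sup>+x. H x * indicator {0<..<1} x \<partial>lborel)"
    by (subst nn_integral_cf_measure) (simp_all add: H_def)
  also have "\<dots> \<le> (\<integral>\<^sup>+x. (\<Sum>a. H x * indicator {1 / (real (Suc a) + 1)..1 / real (Suc a)} x) \<partial>lborel)"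
  proof (rule nn_integral_mono)
    fix x :: real
    show "H x * indicator {0<..<1} x \<le> (\<Sum>a. H x * indicator {1 / (real (Suc a) + 1)..1 / real (Suc a)} x)"
    proof (cases "0 < x \<and> x < 1")
      case True
      then obtain a where a: "x \<in> {1 / (real (Suc a) + 1)..1 / real (Suc a)}" using cover by blast
      have "H x * indicator {0<..<1} x = (\<Sum>b\<in>{a}. H x * indicator {1 / (real (Suc b) + 1)..1 / real (Suc b)} x)"
        using True a by (simp add: indicator_def)
      also have "\<dots> \<le> (\<Sum>b. H x * indicator {1 / (real (Suc b) + 1)..1 / real (Suc b)} x)"
        by (rule sum_le_suminf) auto
      finally show ?thesis .
    qed (auto simp: indicator_def)
  qed
  also have "\<dots> = (\<Sum>a. \<integral>\<^sup>+x. H x * indicator {1 / (real (Suc a) + 1)..1 / real (Suc a)} x \<partial>lborel)"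
    by (rule nn_integral_suminf) measurable
  also have "\<dots> = (\<Sum>a. f (Suc a) * ennreal (cf_weight s (Suc a)) * (\<integral>\<^sup>+u. G u \<partial>cf_measure (1 / (real (Suc a) + s))))"
  proof (rule suminf_cong)
    fix a
    have w: "0 \<le> cf_weight s (Suc a)" using s by (simp add: cf_weight_def)
    have "(\<integral>\<^sup>+x. H x * indicator {1 / (real (Suc a) + 1)..1 / real (Suc a)} x \<partial>lborel) =
      (\<integral>\<^sup>+u. H (1 / (real (Suc a) + u)) * ennreal (1 / (real (Suc a) + u)\<^sup>2) * indicator {0<..<1} u \<partial>lborel)"
      by (rule nn_integral_Gauss_branch) simp_all
    also have "\<dots> = (\<integral>\<^sup>+u. f (Suc a) * ennreal (cf_weight s (Suc a)) *
        (G u * ennreal (cf_density (1 / (real (Suc a) + s)) u) * indicator {0<..<1} u) \<partial>lborel)"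
    proof (rule nn_integral_cong)
      fix u :: real
      show "H (1 / (real (Suc a) + u)) * ennreal (1 / (real (Suc a) + u)\<^sup>2) * indicator {0<..<1} u =
        f (Suc a) * ennreal (cf_weight s (Suc a)) *
        (G u * ennreal (cf_density (1 / (real (Suc a) + s)) u) * indicator {0<..<1} u)"
      proof (cases "0 < u \<and> u < 1")
        case True
        \<comment> \<open>Strictness of \<open>0 < u < 1\<close> makes the floor exact, so
          \<open>Suc a\<close> is the digit and \<open>u\<close> the image under the Gauss
          map.\<close>
        have fl: "\<lfloor>real (Suc a) + u\<rfloor> = int (Suc a)" using True by linarith
        have d: "cf_digit (1 / (real (Suc a) + u)) (Suc 0) = Suc a"
          unfolding cf_digit_def using fl by simp
        have t: "gauss_map (1 / (real (Suc a) + u)) = u"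
          unfolding gauss_map_def frac_def using fl by simp
        have "ennreal (cf_density s (1 / (real (Suc a) + u))) * ennreal (1 / (real (Suc a) + u)\<^sup>2) =
          ennreal (cf_weight s (Suc a)) * ennreal (cf_density (1 / (real (Suc a) + s)) u)"
          using cf_density_branch[of s u "Suc a"] s True w
          by (subst (1 2) ennreal_mult[symmetric]) (simp_all add: cf_density_def)
        then show ?thesis unfolding H_def d t by (simp add: mult_ac)
      qed (auto simp: indicator_def)
    qed
    also have "\<dots> = f (Suc a) * ennreal (cf_weight s (Suc a)) * (\<integral>\<^sup>+u. G u \<partial>cf_measure (1 / (real (Suc a) + s)))"
      by (subst nn_integral_cmult) (simp_all add: nn_integral_cf_measure)
    finally show "(\<integral>\<^sup>+x. H x * indicator {1 / (real (Suc a) + 1)..1 / real (Suc a)} x \<partial>lborel) =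
      f (Suc a) * ennreal (cf_weight s (Suc a)) * (\<integral>\<^sup>+u. G u \<partial>cf_measure (1 / (real (Suc a) + s)))" .
  qed
  finally show ?thesis .
qed

text \<open>Replaces independence. The bound \<open>\<rho> i\<close> holds uniformly in the
  parameter, so it survives the change from \<open>s\<close> to \<open>1 / (a + s)\<close> after the
  first digit. Hence the induction generalizes over \<open>s\<close>, \<open>f\<close> and
  \<open>\<rho>\<close>.\<close>

lemma nn_integral_prod_cf_digit_le:
  fixes f :: "nat \<Rightarrow> nat \<Rightarrow> ennreal" and \<rho> :: "nat \<Rightarrow> ennreal"
  assumes "0 \<le> s"
    and "\<And>i s. i < n \<Longrightarrow> 0 \<le> s \<Longrightarrow> (\<Sum>a. f i (Suc a) * ennreal (cf_weight s (Suc a))) \<le> \<rho> i"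
  shows "(\<integral>\<^sup>+x. (\<Prod>i<n. f i (cf_digit x (Suc i))) \<partial>cf_measure s) \<le> (\<Prod>i<n. \<rho> i)"
  using assms
proof (induction n arbitrary: f \<rho> s)
  case 0
  then show ?case using emeasure_cf_measure_UNIV[of s] by simp
next
  case (Suc n)
  let ?G = "\<lambda>x. \<Prod>i<n. f (Suc i) (cf_digit x (Suc i))"
  have "(\<integral>\<^sup>+x. (\<Prod>i<Suc n. f i (cf_digit x (Suc i))) \<partial>cf_measure s) =
      (\<integral>\<^sup>+x. f 0 (cf_digit x (Suc 0)) * ?G (gauss_map x) \<partial>cf_measure s)"
    by (simp only: prod.lessThan_Suc_shift cf_digit_shift)
  also have "\<dots> \<le> (\<Sum>a. f 0 (Suc a) * ennreal (cf_weight s (Suc a)) *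
      (\<integral>\<^sup>+u. ?G u \<partial>cf_measure (1 / (real (Suc a) + s))))"
    by (rule nn_integral_cf_measure_step) (use Suc.prems in measurable)
  also have "\<dots> \<le> (\<Sum>a. f 0 (Suc a) * ennreal (cf_weight s (Suc a)) * (\<Prod>i<n. \<rho> (Suc i)))"
    by (intro suminf_le mult_left_mono Suc.IH Suc.prems(2)) (use Suc.prems(1) in auto)
  also have "\<dots> = (\<Sum>a. f 0 (Suc a) * ennreal (cf_weight s (Suc a))) * (\<Prod>i<n. \<rho> (Suc i))"
    by (rule ennreal_suminf_multc)
  also have "\<dots> \<le> \<rho> 0 * (\<Prod>i<n. \<rho> (Suc i))"
    using Suc.prems by (intro mult_right_mono) auto
  finally show ?case by (simp only: prod.lessThan_Suc_shift)
qed

section \<open>Tail, truncated mean and Laplace transform of one digit\<close>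

lemma cf_weight_nonneg: "0 \<le> s \<Longrightarrow> 0 \<le> cf_weight s a"
  by (simp add: cf_weight_def)

text \<open>By partial fractions the weights telescope. The first \<open>j - 1\<close> terms vanish,
  so the series is shifted to start at digit \<open>j\<close>.\<close>

lemma cf_weight_tail_sums:
  assumes "0 \<le> s" "1 \<le> j"
  shows "(\<lambda>a. of_bool (j \<le> Suc a) * cf_weight s (Suc a)) sums ((1 + s) / (real j + s))"
proof -
  have w: "cf_weight s a = (1 + s) / (real a + s) - (1 + s) / (real (Suc a) + s)" if "1 \<le> a" for a
    using assms that unfolding cf_weight_def by (simp add: divide_simps) (simp add: algebra_simps)
  have "(\<lambda>a. (1 + s) / (real a + s)) \<longlonglongrightarrow> 0"
    by real_asymp
  then have lim: "(\<lambda>i. (1 + s) / (real (i + j) + s)) \<longlonglongrightarrow> 0"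
    by (rule LIMSEQ_ignore_initial_segment)
  have "(\<lambda>i. of_bool (j \<le> Suc (i + (j - 1))) * cf_weight s (Suc (i + (j - 1)))) sums ((1 + s) / (real j + s))"
    using telescope_sums'[OF lim] assms(2) by (simp add: w add_ac)
  moreover have "(\<Sum>i<j - 1. of_bool (j \<le> Suc i) * cf_weight s (Suc i)) = 0"
    by (intro sum.neutral) auto
  ultimately show ?thesis by (subst (asm) sums_iff_shift) simp
qed

lemma cf_weight_sums_1: "0 \<le> s \<Longrightarrow> (\<lambda>a. cf_weight s (Suc a)) sums 1"
  using cf_weight_tail_sums[of s 1] by simp

lemma sum_of_bool_le_eq_min: "(\<Sum>j\<in>{1..M}. of_bool (j \<le> a)) = real (min a M)"
proof -
  have "(\<Sum>j\<in>{1..M}. of_bool (j \<le> a)) = real (card ({1..M} \<inter> {j. j \<le> a}))"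
    by (simp add: of_bool_def sum.If_cases)
  also have "{1..M} \<inter> {j. j \<le> a} = {1..min a M}" by auto
  finally show ?thesis by simp
qed

text \<open>Layer-cake formula: the mean of a digit truncated at \<open>M\<close> is the sum over
  \<open>j \<le> M\<close> of the probabilities that the digit is at least \<open>j\<close>.\<close>

lemma truncated_mean_sums:
  assumes "0 \<le> s"
  shows "(\<lambda>a. real (min (Suc a) M) * cf_weight s (Suc a)) sums (\<Sum>j\<in>{1..M}. (1 + s) / (real j + s))"
proof -
  have "(\<lambda>a. \<Sum>j\<in>{1..M}. of_bool (j \<le> Suc a) * cf_weight s (Suc a)) sums (\<Sum>j\<in>{1..M}. (1 + s) / (real j + s))"
    by (intro sums_sum cf_weight_tail_sums assms) auto
  then show ?thesis unfolding sum_distrib_right[symmetric] sum_of_bool_le_eq_min .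
qed

text \<open>For \<open>j \<ge> 1\<close> one has \<open>s \<le> s * j\<close>, hence
  \<open>(1 + s) / (j + s) \<ge> 1 / j\<close>. The harmonic sum is thus a lower bound uniform in
  \<open>s\<close>.\<close>

lemma truncated_mean_ge_ln:
  assumes "0 \<le> s" "1 \<le> M"
  shows "ln (real M) \<le> (\<Sum>j\<in>{1..M}. (1 + s) / (real j + s))"
proof -
  have "ln (real M) \<le> ln (real M + 1)" using assms by simp
  also have "\<dots> \<le> harm M" by (rule ln_le_harm)
  also have "\<dots> \<le> (\<Sum>j\<in>{1..M}. (1 + s) / (real j + s))"
    unfolding harm_def
  proof (rule sum_mono)
    fix j assume "j \<in> {1..M}"
    then have "s \<le> s * real j" "1 \<le> real j" using assms(1) mult_left_mono[of 1 "real j" s] by auto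
    then show "inverse (real j) \<le> (1 + s) / (real j + s)"
      using assms(1) by (simp add: field_simps)
  qed
  finally show ?thesis .
qed

text \<open>A linear upper bound for the exponential, which reduces a Laplace transform to a mean.
  It follows from \<open>exp x \<ge> 1 + x\<close> and \<open>(1 + x) * (1 - x / 2) \<ge> 1\<close>
  on the unit interval.\<close>

lemma exp_minus_le: "exp (- x) \<le> 1 - x / 2" if "0 \<le> x" "x \<le> 1" for x :: real
proof -
  have "exp (- x) = 1 / exp x" by (simp add: exp_minus field_simps)
  also have "\<dots> \<le> 1 / (1 + x)" using that by (intro divide_left_mono) auto
  also have "\<dots> \<le> 1 - x / 2"
    using that mult_left_mono[of x 1 x] by (simp add: field_simps)
  finally show ?thesis .
qed

text \<open>Scaling by \<open>1 / M\<close> keeps the exponent in the unit interval, where the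
  linear bound applies. Inserting the truncated mean and then \<open>1 - y \<le> exp (- y)\<close>
  gives the claim.\<close>

lemma digit_Laplace_le:
  assumes "0 \<le> s" "1 \<le> M"
  shows "(\<Sum>a. ennreal (exp (- (real (min (Suc a) M) / real M))) * ennreal (cf_weight s (Suc a)))
    \<le> ennreal (exp (- (ln (real M) / (2 * real M))))"
proof -
  let ?w = "\<lambda>a. cf_weight s (Suc a)" and ?m = "\<lambda>a. real (min (Suc a) M)"
  let ?L = "\<Sum>j\<in>{1..M}. (1 + s) / (real j + s)"
  have w0: "0 \<le> ?w a" for a using assms by (intro cf_weight_nonneg)
  from sums_diff[OF cf_weight_sums_1[OF assms(1)] sums_mult[OF truncated_mean_sums[OF assms(1), of M], of "1 / (2 * real M)"]]
  have S: "(\<lambda>a. (1 - ?m a / real M / 2) * ?w a) sums (1 - 1 / (2 * real M) * ?L)"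
    by (simp add: algebra_simps)
  have le: "exp (- (?m a / real M)) \<le> 1 - ?m a / real M / 2" for a
    by (rule exp_minus_le) (use assms in auto)
  have nn: "0 \<le> (1 - ?m a / real M / 2) * ?w a" for a
    using order_trans[OF _ le[of a], of 0] w0[of a] by simp
  have "(\<Sum>a. ennreal (exp (- (?m a / real M))) * ennreal (?w a)) \<le> (\<Sum>a. ennreal ((1 - ?m a / real M / 2) * ?w a))"
  proof (intro suminf_le)
    fix a
    show "ennreal (exp (- (?m a / real M))) * ennreal (?w a) \<le> ennreal ((1 - ?m a / real M / 2) * ?w a)"
      using le[of a] w0[of a] by (subst ennreal_mult[symmetric]) (auto intro!: ennreal_leI mult_right_mono)
  qed auto
  also have "\<dots> = ennreal (1 - 1 / (2 * real M) * ?L)"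
    using suminf_ennreal_eq[OF nn S] .
  also have "\<dots> \<le> ennreal (exp (- (ln (real M) / (2 * real M))))"
  proof (rule ennreal_leI)
    have "1 - 1 / (2 * real M) * ?L \<le> 1 - ln (real M) / (2 * real M)"
      using truncated_mean_ge_ln[OF assms] assms(2) by (simp add: field_simps)
    also have "\<dots> \<le> exp (- (ln (real M) / (2 * real M)))"
      using exp_ge_add_one_self[of "- (ln (real M) / (2 * real M))"] by simp
    finally show "1 - 1 / (2 * real M) * ?L \<le> exp (- (ln (real M) / (2 * real M)))" .
  qed
  finally show ?thesis .
qed


section \<open>Chernoff bound for the digits in a block\<close>

lemma truncated_digit_sum_tail:
  assumes B: "B \<subseteq> {1..n}" and M: "1 \<le> M"
  shows "emeasure lborel {x \<in> {0<..<1}. (\<Sum>i\<in>B. real (min (cf_digit x i) M)) < real (card B) * ln (real M) / 4}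
    \<le> ennreal (exp (- (real (card B) * ln (real M) / (4 * real M))))" (is "emeasure _ ?E \<le> _")
proof -
  \<comment> \<open>Indices outside \<open>B\<close> get the factor 1, so the product estimate for
    the first \<open>n\<close> digits also covers an arbitrary subset \<open>B\<close>.\<close>
  define f where "f i a = (if Suc i \<in> B then ennreal (exp (- (real (min a M) / real M))) else 1)" for i a
  define \<rho> where "\<rho> i = (if Suc i \<in> B then ennreal (exp (- (ln (real M) / (2 * real M)))) else 1)" for i
  \<comment> \<open>\<open>c\<close> is the threshold divided by \<open>M\<close>, and the Laplace
    transform is at most \<open>exp (- (2 * c))\<close>. Markov's inequality costs a factor
    \<open>exp c\<close>, leaving \<open>exp (- c)\<close>.\<close>
  define c where "c = real (card B) * ln (real M) / (4 * real M)"
  have fin: "finite B" using B finite_subset by blast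
  have restrict: "(\<Prod>i<n. if Suc i \<in> B then g (Suc i) else 1) = (\<Prod>i\<in>B. g i)" for g :: "nat \<Rightarrow> ennreal"
    using prod.inter_restrict[of "{1..n}" g B] B
    by (simp add: prod.atLeast1_atMost_eq Int_absorb1)
  have E: "?E \<in> sets borel" by measurable
  have "(\<integral>\<^sup>+x. (\<Prod>i<n. f i (cf_digit x (Suc i))) \<partial>cf_measure 0) \<le> (\<Prod>i<n. \<rho> i)"
  proof (rule nn_integral_prod_cf_digit_le)
    fix i :: nat and s :: real assume "0 \<le> s"
    have "(\<Sum>a. ennreal (cf_weight s (Suc a))) = 1"
      using suminf_ennreal_eq[OF cf_weight_nonneg cf_weight_sums_1] \<open>0 \<le> s\<close> by simp
    then show "(\<Sum>a. f i (Suc a) * ennreal (cf_weight s (Suc a))) \<le> \<rho> i"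
      using digit_Laplace_le[OF \<open>0 \<le> s\<close> M] by (simp add: f_def \<rho>_def del: of_nat_Suc)
  qed simp
  also have "(\<Prod>i<n. \<rho> i) = (\<Prod>i\<in>B. ennreal (exp (- (ln (real M) / (2 * real M)))))"
    unfolding \<rho>_def by (rule restrict)
  also have "\<dots> = ennreal (exp (- (2 * c)))"
    by (simp add: ennreal_power exp_of_nat_mult[symmetric] c_def)
  finally have Laplace: "(\<integral>\<^sup>+x. (\<Prod>i<n. f i (cf_digit x (Suc i))) \<partial>cf_measure 0) \<le> ennreal (exp (- (2 * c)))" .
  have prod_f: "(\<Prod>i<n. f i (cf_digit x (Suc i))) = ennreal (exp (- ((\<Sum>i\<in>B. real (min (cf_digit x i) M)) / real M)))" for x
  proof -
    have "(\<Prod>i<n. f i (cf_digit x (Suc i))) = (\<Prod>i\<in>B. ennreal (exp (- (real (min (cf_digit x i) M) / real M))))"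
      unfolding f_def by (rule restrict)
    then show ?thesis using fin
      by (simp add: prod_ennreal exp_sum[symmetric] sum_negf sum_divide_distrib)
  qed
  have "emeasure lborel ?E = (\<integral>\<^sup>+x. indicator ?E x \<partial>lborel)" using E by simp
  also have "\<dots> = (\<integral>\<^sup>+x. indicator ?E x \<partial>cf_measure 0)"
    by (subst nn_integral_cf_measure, use E in simp, rule nn_integral_cong)
       (auto simp: cf_density_def indicator_def)
  also have "\<dots> \<le> (\<integral>\<^sup>+x. ennreal (exp c) * (\<Prod>i<n. f i (cf_digit x (Suc i))) \<partial>cf_measure 0)"
  proof (rule nn_integral_mono)
    fix x
    show "indicator ?E x \<le> ennreal (exp c) * (\<Prod>i<n. f i (cf_digit x (Suc i)))"
    proof (cases "x \<in> ?E")
      case True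
      then have "(\<Sum>i\<in>B. real (min (cf_digit x i) M)) / real M \<le> c"
        using M by (simp add: c_def field_simps)
      then have "1 \<le> ennreal (exp (c - (\<Sum>i\<in>B. real (min (cf_digit x i) M)) / real M))" by simp
      then show ?thesis
        unfolding prod_f by (simp add: ennreal_mult[symmetric] exp_add[symmetric] indicator_def)
    qed simp
  qed
  also have "\<dots> = ennreal (exp c) * (\<integral>\<^sup>+x. (\<Prod>i<n. f i (cf_digit x (Suc i))) \<partial>cf_measure 0)"
    by (rule nn_integral_cmult) (simp add: prod_f)
  also have "\<dots> \<le> ennreal (exp c) * ennreal (exp (- (2 * c)))"
    by (intro mult_left_mono Laplace) simp
  also have "\<dots> = ennreal (exp (- c))"
    by (simp add: ennreal_mult[symmetric] exp_add[symmetric])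
  finally show ?thesis unfolding c_def .
qed

section \<open>Deterministic lower bound for the symmetric mean\<close>

lemma prod_block_sums_le_esym:
  fixes a :: "nat \<Rightarrow> real"
  assumes "finite A" "finite L" and B: "\<And>l. l \<in> L \<Longrightarrow> B l \<subseteq> A" and disj: "disjoint_family_on B L"
    and a: "\<And>i. i \<in> A \<Longrightarrow> 0 \<le> a i"
  shows "(\<Prod>l\<in>L. \<Sum>i\<in>B l. a i) \<le> (\<Sum>I\<in>{I. I \<subseteq> A \<and> card I = card L}. \<Prod>i\<in>I. a i)"
proof -
  have eq: "l = l'" if "l \<in> L" "l' \<in> L" "i \<in> B l" "i \<in> B l'" for l l' i
    using disjoint_family_onD[OF disj that(1,2)] that(3,4) by blast
  have inj: "inj_on p L" if "p \<in> PiE L B" for p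
    by (rule inj_onI) (metis eq PiE_mem[OF that])
  have inj_image: "inj_on (\<lambda>p. p ` L) (PiE L B)"
  proof (rule inj_onI)
    fix p q assume pq: "p \<in> PiE L B" "q \<in> PiE L B" "p ` L = q ` L"
    show "p = q"
    proof (rule PiE_ext[OF pq(1,2)])
      fix l assume l: "l \<in> L"
      then obtain l' where l': "l' \<in> L" "p l = q l'" using pq(3) by blast
      then have "l' = l"
        using eq[OF l'(1) l] PiE_mem[OF pq(2) l'(1)] PiE_mem[OF pq(1) l] by simp
      then show "p l = q l" using l' by simp
    qed
  qed
  have "(\<Prod>l\<in>L. \<Sum>i\<in>B l. a i) = (\<Sum>p\<in>PiE L B. \<Prod>l\<in>L. a (p l))"
    using assms by (intro prod_sum_PiE) (auto intro: finite_subset)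
  also have "\<dots> = (\<Sum>p\<in>PiE L B. \<Prod>i\<in>p ` L. a i)"
    by (intro sum.cong refl) (simp add: prod.reindex[OF inj])
  also have "\<dots> = (\<Sum>I\<in>(\<lambda>p. p ` L) ` PiE L B. \<Prod>i\<in>I. a i)"
    by (simp add: sum.reindex[OF inj_image])
  also have "\<dots> \<le> (\<Sum>I\<in>{I. I \<subseteq> A \<and> card I = card L}. \<Prod>i\<in>I. a i)"
  proof (rule sum_mono2)
    show "finite {I. I \<subseteq> A \<and> card I = card L}" using assms(1) by simp
    show "(\<lambda>p. p ` L) ` PiE L B \<subseteq> {I. I \<subseteq> A \<and> card I = card L}"
      using B by (auto simp: card_image[OF inj] dest: PiE_mem)
  qed (auto intro!: prod_nonneg a)
  finally show ?thesis .
qed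

text \<open>The left side divided by \<open>fact k\<close> is a single term of the exponential
  series at \<open>k\<close>.\<close>

lemma power_le_exp_fact: "real k ^ k \<le> exp (real k) * fact k"
proof -
  have "(\<Sum>i\<in>{k}. real k ^ i /\<^sub>R fact i) \<le> (\<Sum>i. real k ^ i /\<^sub>R fact i)"
    by (intro sum_le_suminf summable_exp_generic) auto
  then show ?thesis by (simp add: exp_def divide_simps mult_ac)
qed

text \<open>Combines \<open>n choose k \<le> n ^ k / fact k\<close> with
  \<open>n \<le> 2 * m * k\<close>, where \<open>m = n div k \<ge> 1\<close>, and with the preceding
  bound on \<open>k ^ k\<close>.\<close>

lemma binomial_le_div_power:
  assumes "1 \<le> k" "k \<le> n"
  shows "real (n choose k) \<le> (2 * exp 1 * real (n div k)) ^ k"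
proof -
  define m where "m = n div k"
  have "1 \<le> m" using assms by (simp add: m_def div_greater_zero_iff Suc_le_eq)
  have "n = k * m + n mod k" by (simp add: m_def)
  moreover have "n mod k < k" using assms by simp
  ultimately have "n \<le> k * m + k" by linarith
  also have "\<dots> \<le> 2 * m * k" using \<open>1 \<le> m\<close> by simp
  finally have n: "real n \<le> 2 * real m * real k" by (metis of_nat_le_iff of_nat_mult of_nat_numeral)
  have "real (n choose k) * fact k \<le> real n ^ k"
    using binomial_fact_pow[of n k] by (metis of_nat_fact of_nat_le_iff of_nat_mult of_nat_power)
  also have "\<dots> \<le> (2 * real m * real k) ^ k" by (intro power_mono n) simp
  also have "\<dots> = (2 * real m) ^ k * real k ^ k" by (simp add: power_mult_distrib)
  also have "\<dots> \<le> (2 * real m) ^ k * (exp (real k) * fact k)"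
    by (intro mult_left_mono power_le_exp_fact) simp
  also have "\<dots> = (2 * exp 1 * real m) ^ k * fact k"
    using exp_of_nat_mult[of k "1::real"] by (simp add: power_mult_distrib mult_ac)
  finally show ?thesis by (simp add: m_def)
qed

text \<open>The numerator is at least \<open>(m * b) ^ k\<close> and the binomial coefficient at
  most \<open>(2 * exp 1 * m) ^ k\<close>, with \<open>m = n div k\<close>. The block length
  cancels.\<close>

lemma S_cf_ge_if_block_sums_ge:
  assumes k: "1 \<le> k" "k \<le> n" and "0 \<le> b"
    and block: "\<And>l. l < k \<Longrightarrow> real (n div k) * b \<le> (\<Sum>i\<in>{l * (n div k)<..Suc l * (n div k)}. real (cf_digit x i))"
  shows "S_cf x n k \<ge> (b / (2 * exp 1)) ^ k"
proof -
  define m where "m = n div k"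
  have m: "1 \<le> m" using k by (simp add: m_def div_greater_zero_iff Suc_le_eq)
  have sub: "{l * m<..Suc l * m} \<subseteq> {1..n}" if "l < k" for l
  proof -
    have "Suc l * m \<le> k * m" using that by (intro mult_le_mono1) simp
    also have "\<dots> \<le> n" by (simp add: m_def)
    finally show ?thesis by auto
  qed
  have disj: "disjoint_family_on (\<lambda>l. {l * m<..Suc l * m}) {..<k}"
  proof -
    have "l = l'" if "l * m < i" "i \<le> Suc l * m" "l' * m < i" "i \<le> Suc l' * m" for l l' i
    proof -
      have "l * m < Suc l' * m" "l' * m < Suc l * m" using that by linarith+
      then show "l = l'" unfolding mult_less_cancel2 by auto
    qed
    then have "{l * m<..Suc l * m} \<inter> {l' * m<..Suc l' * m} = {}" if "l \<noteq> l'" for l l'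
      using that by (metis disjoint_iff greaterThanAtMost_iff)
    then show ?thesis unfolding disjoint_family_on_def by blast
  qed
  have "(b / (2 * exp 1)) ^ k * real (n choose k) \<le> (b / (2 * exp 1)) ^ k * (2 * exp 1 * real m) ^ k"
    using binomial_le_div_power[OF k] assms(3) by (intro mult_left_mono) (auto simp: m_def)
  also have "\<dots> = (\<Prod>l<k. real m * b)"
    by (simp add: power_mult_distrib[symmetric] mult_ac)
  also have "\<dots> \<le> (\<Prod>l<k. \<Sum>i\<in>{l * m<..Suc l * m}. real (cf_digit x i))"
    using block assms(3) by (intro prod_mono) (simp add: m_def)
  also have "\<dots> \<le> (\<Sum>I\<in>{I. I \<subseteq> {1..n} \<and> card I = card {..<k}}. \<Prod>i\<in>I. real (cf_digit x i))"
    using sub disj by (intro prod_block_sums_le_esym) auto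
  finally show ?thesis
    using k by (simp add: S_cf_def pos_le_divide_eq zero_less_binomial)
qed

section \<open>Union bound over the blocks\<close>

lemma measurable_S_cf [measurable]: "(\<lambda>x. S_cf x n k) \<in> borel_measurable borel"
  unfolding S_cf_def by measurable

lemma Rats_null_sets_lborel: "\<rat> \<in> null_sets (lborel :: real measure)"
  by (intro countable_imp_null_set_lborel countable_rat)

lemma sets_borel_Rats [measurable]: "\<rat> \<in> sets (borel :: real measure)"
  using Rats_null_sets_lborel by auto

lemma measure_S_cf_ge:
  assumes k: "1 \<le> k" "k \<le> n" and M: "1 \<le> M"
  shows "measure lborel {x \<in> {0<..<1}. x \<notin> \<rat> \<and> S_cf x n k \<ge> (ln (real M) / (8 * exp 1)) ^ k}
    \<ge> 1 - real k * exp (- (real (n div k) * ln (real M) / (4 * real M)))"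
proof -
  define m where "m = n div k"
  define B where "B l = {l * m<..Suc l * m}" for l
  define \<epsilon> where "\<epsilon> = exp (- (real m * ln (real M) / (4 * real M)))"
  let ?G = "{x \<in> {0<..<1}. x \<notin> \<rat> \<and> S_cf x n k \<ge> (ln (real M) / (8 * exp 1)) ^ k}"
  let ?E = "\<lambda>l. {x \<in> {0<..<1::real}. (\<Sum>i\<in>B l. real (min (cf_digit x i) M)) < real (card (B l)) * ln (real M) / 4}"
  have card_B: "card (B l) = m" for l by (simp add: B_def)
  have "B l \<subseteq> {1..Suc l * m}" for l by (auto simp: B_def)
  from truncated_digit_sum_tail[OF this M]
  have E: "emeasure lborel (?E l) \<le> ennreal \<epsilon>" for l
    unfolding card_B \<epsilon>_def .
  have E_sets: "?E l \<in> sets borel" for l by measurable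
  have G_sets: "?G \<in> sets borel" by measurable
  have cover: "{0<..<1} \<subseteq> ?G \<union> (\<rat> \<union> (\<Union>l<k. ?E l))"
  proof
    fix x :: real assume x: "x \<in> {0<..<1}"
    show "x \<in> ?G \<union> (\<rat> \<union> (\<Union>l<k. ?E l))"
    proof (rule ccontr)
      assume *: "x \<notin> ?G \<union> (\<rat> \<union> (\<Union>l<k. ?E l))"
      \<comment> \<open>Outside all exceptional sets every block sum is large, since truncation only
        lowers digits. The constant \<open>8 * exp 1\<close> is the Chernoff factor 4 times the
        binomial factor \<open>2 * exp 1\<close>.\<close>
      have "S_cf x n k \<ge> (ln (real M) / 4 / (2 * exp 1)) ^ k"
      proof (rule S_cf_ge_if_block_sums_ge[OF k])
        fix l assume "l < k"
        then have "real m * (ln (real M) / 4) \<le> (\<Sum>i\<in>B l. real (min (cf_digit x i) M))"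
          using * x by (auto simp: card_B not_less)
        also have "\<dots> \<le> (\<Sum>i\<in>B l. real (cf_digit x i))" by (intro sum_mono) simp
        finally show "real (n div k) * (ln (real M) / 4) \<le>
          (\<Sum>i\<in>{l * (n div k)<..Suc l * (n div k)}. real (cf_digit x i))"
          by (simp add: B_def m_def)
      qed (use M in simp)
      then show False using * x by auto
    qed
  qed
  have "emeasure lborel (\<Union>l<k. ?E l) \<le> (\<Sum>l<k. emeasure lborel (?E l))"
    by (intro emeasure_subadditive_finite) (use E_sets in auto)
  also have "\<dots> \<le> (\<Sum>l<k. ennreal \<epsilon>)" by (intro sum_mono E)
  also have "\<dots> = ennreal (real k * \<epsilon>)"
    by (simp add: ennreal_mult ennreal_of_nat_eq_real_of_nat \<epsilon>_def)
  finally have bad: "emeasure lborel (\<Union>l<k. ?E l) \<le> ennreal (real k * \<epsilon>)" .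
  have G: "emeasure lborel ?G = ennreal (measure lborel ?G)"
  proof (rule emeasure_eq_ennreal_measure)
    have "emeasure lborel ?G \<le> emeasure lborel {0<..<1::real}" by (intro emeasure_mono) auto
    then show "emeasure lborel ?G \<noteq> top" by (auto simp: top_unique)
  qed
  have "ennreal 1 = emeasure lborel {0<..<1::real}" by simp
  also have "\<dots> \<le> emeasure lborel (?G \<union> (\<rat> \<union> (\<Union>l<k. ?E l)))"
    using cover by (rule emeasure_mono) (use E_sets G_sets in auto)
  also have "\<dots> \<le> emeasure lborel ?G + (emeasure lborel (\<rat> :: real set) + emeasure lborel (\<Union>l<k. ?E l))"
    by (intro order_trans[OF emeasure_subadditive] add_mono order_refl emeasure_subadditive)
       (use E_sets G_sets in auto)
  also have "\<dots> \<le> ennreal (measure lborel ?G) + (0 + ennreal (real k * \<epsilon>))"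
    by (intro add_mono bad) (use G Rats_null_sets_lborel in auto)
  finally have "ennreal 1 \<le> ennreal (measure lborel ?G + real k * \<epsilon>)"
    by (simp add: \<epsilon>_def)
  then have "1 \<le> measure lborel ?G + real k * \<epsilon>"
    by (subst (asm) ennreal_le_iff) (auto simp: \<epsilon>_def)
  then show ?thesis by (simp add: \<epsilon>_def m_def)
qed

section \<open>Choice of the truncation level and asymptotics\<close>

lemma nat_floor_sqrt_bounds:
  assumes "256 \<le> m"
  defines "M \<equiv> nat \<lfloor>sqrt (real m)\<rfloor>"
  shows "3 \<le> M" "real M \<le> sqrt (real m)" "ln (real m) \<le> 4 * ln (real M)"
proof -
  define t where "t = sqrt (real m)"
  have "sqrt 256 \<le> t" unfolding t_def using assms by (intro real_sqrt_le_mono) simp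
  moreover have "sqrt (256::real) = 16" by (rule real_sqrt_unique) auto
  ultimately have t: "16 \<le> t" by simp
  have M: "t - 1 \<le> real M" "real M \<le> t" using t unfolding M_def t_def by linarith+
  show "3 \<le> M" using M t by linarith
  show "real M \<le> sqrt (real m)" using M by (simp add: t_def)
  \<comment> \<open>For \<open>t \<ge> 16\<close> the square of \<open>t - 1\<close> dominates
    \<open>t\<close>, so \<open>t \<le> M ^ 2\<close> and \<open>m = t ^ 2 \<le> M ^ 4\<close>. This
    is the source of the factor 4 between the logarithms.\<close>
  have "16 * t \<le> t * t" using t by (intro mult_right_mono) auto
  moreover have "(t - 1)\<^sup>2 = t * t - 2 * t + 1" by (simp add: power2_eq_square algebra_simps)
  ultimately have "t \<le> (t - 1)\<^sup>2" using t by linarith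
  also have "\<dots> \<le> (real M)\<^sup>2" using M t by (intro power_mono) auto
  finally have "t\<^sup>2 \<le> ((real M)\<^sup>2)\<^sup>2" using t by (intro power_mono) auto
  then have "real m \<le> real M ^ 4" by (simp add: t_def)
  then have "ln (real m) \<le> ln (real M ^ 4)"
    using assms(1) \<open>3 \<le> M\<close> by (subst ln_le_cancel_iff) auto
  also have "\<dots> = 4 * ln (real M)" using \<open>3 \<le> M\<close> by (simp add: ln_realpow)
  finally show "ln (real m) \<le> 4 * ln (real M)" .
qed

theorem theorem6p5:
  shows "\<exists>\<delta> C N::real. \<delta> > 0 \<and> C > 0 \<and> N > 0 \<and>
    (\<forall>n k::nat. real n \<ge> N \<longrightarrow> 1 \<le> k \<longrightarrow> real k \<le> real n powr (3/4) \<longrightarrow>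
       measure lborel {\<alpha> \<in> {0<..<1::real}. \<alpha> \<notin> \<rat> \<and>
           S_cf \<alpha> n k \<ge> (C * ln (real (n div k))) ^ k}
         \<ge> 1 - exp (- \<delta> * (ln (real n))\<^sup>2))"
proof -
  \<comment> \<open>Since \<open>k \<le> n powr (3/4)\<close>, the block length is at least about
    \<open>n powr (1/4)\<close>, with square root at least \<open>n powr (1/8) / 2\<close>. The
    failure probability is then at most the left side at \<open>x = n\<close>, which allows
    \<open>\<delta> = 1\<close>.\<close>
  have "\<forall>\<^sub>F x :: real in at_top. x * exp (- (x powr (1/8) / 8)) \<le> exp (- ((ln x)\<^sup>2))"
    by real_asymp
  moreover have "\<forall>\<^sub>F x :: real in at_top. 257 \<le> x powr (1/4)"
    by real_asymp
  ultimately have "\<forall>\<^sub>F x :: real in at_top. x * exp (- (x powr (1/8) / 8)) \<le> exp (- ((ln x)\<^sup>2)) \<and> 257 \<le> x powr (1/4)"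
    by (rule eventually_conj)
  then obtain N0 where N0: "\<And>x :: real. N0 \<le> x \<Longrightarrow> x * exp (- (x powr (1/8) / 8)) \<le> exp (- ((ln x)\<^sup>2))"
    "\<And>x :: real. N0 \<le> x \<Longrightarrow> 257 \<le> x powr (1/4)"
    unfolding eventually_at_top_linorder by blast
  have "measure lborel {\<alpha> \<in> {0<..<1::real}. \<alpha> \<notin> \<rat> \<and> S_cf \<alpha> n k \<ge> (1 / 96 * ln (real (n div k))) ^ k}
      \<ge> 1 - exp (- 1 * (ln (real n))\<^sup>2)" (is "measure _ ?G \<ge> _")
    if n: "max N0 1 \<le> real n" and k: "1 \<le> k" "real k \<le> real n powr (3/4)" for n k :: nat
  proof -
    define m where "m = n div k"
    define M where "M = nat \<lfloor>sqrt (real m)\<rfloor>"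
    have n1: "1 \<le> real n" using n by simp
    have "real n powr (3/4) \<le> real n powr 1" using n1 by (intro powr_mono) auto
    then have "k \<le> n" using k n1 by simp
    have "real n powr (1/4) * real k \<le> real n powr (1/4) * real n powr (3/4)"
      using k by (intro mult_left_mono) auto
    also have "\<dots> = real n" using n1 by (simp add: powr_add[symmetric])
    also have "\<dots> \<le> (real m + 1) * real k"
    proof -
      have "n < (m + 1) * k" using k unfolding m_def by (simp add: dividend_less_div_times)
      then have "real n \<le> real ((m + 1) * k)" by (simp only: of_nat_le_iff)
      then show ?thesis by (simp add: algebra_simps)
    qed
    finally have m1: "real n powr (1/4) \<le> real m + 1" using k by simp
    \<comment> \<open>The threshold 257 absorbs the loss of 1 from integer division and makes the
      bounds for \<open>M\<close> applicable.\<close>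
    then have m: "256 \<le> m" "real n powr (1/4) / 4 \<le> real m" using N0(2)[of "real n"] n by auto
    note M = nat_floor_sqrt_bounds[OF m(1), folded M_def]
    have "(real n powr (1/8) / 2)\<^sup>2 = real n powr (1/4) / 4"
      using n1 by (simp add: power2_eq_square powr_add[symmetric])
    then have root_m: "real n powr (1/8) / 2 \<le> sqrt (real m)"
      using m(2) by (intro real_le_rsqrt) simp
    have "1 \<le> ln (real M)"
      using M(1) exp_le by (subst ln_ge_iff) auto
    have "sqrt (real m) * real M \<le> sqrt (real m) * sqrt (real m)"
      using M by (intro mult_left_mono) auto
    also have "\<dots> \<le> real m * ln (real M)" using \<open>1 \<le> ln (real M)\<close> mult_left_mono[of 1 "ln (real M)" "real m"] by simp
    finally have "sqrt (real m) / 4 \<le> real m * ln (real M) / (4 * real M)"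
      using M(1) by (simp add: field_simps)
    then have expo: "real n powr (1/8) / 8 \<le> real m * ln (real M) / (4 * real M)"
      using root_m by linarith
    have "real k * exp (- (real m * ln (real M) / (4 * real M))) \<le> real n * exp (- (real n powr (1/8) / 8))"
      using \<open>k \<le> n\<close> expo by (intro mult_mono) auto
    also have "\<dots> \<le> exp (- ((ln (real n))\<^sup>2))" using N0(1)[of "real n"] n by simp
    finally have bad: "real k * exp (- (real m * ln (real M) / (4 * real M))) \<le> exp (- 1 * (ln (real n))\<^sup>2)" by simp
    \<comment> \<open>The constant is \<open>1 / (4 * 24)\<close>: 4 compares \<open>ln m\<close>
      with \<open>ln M\<close>, and 24 bounds \<open>8 * exp 1\<close> because
      \<open>exp 1 \<le> 3\<close>.\<close>
    have "1 / 96 * ln (real m) \<le> ln (real M) / 24" using M(3) by simp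
    also have "\<dots> \<le> ln (real M) / (8 * exp 1)"
      using exp_le \<open>1 \<le> ln (real M)\<close> by (intro divide_left_mono) auto
    finally have C: "(1 / 96 * ln (real m)) ^ k \<le> (ln (real M) / (8 * exp 1)) ^ k"
      using m(1) by (intro power_mono) auto
    have "1 - exp (- 1 * (ln (real n))\<^sup>2) \<le> 1 - real k * exp (- (real m * ln (real M) / (4 * real M)))"
      using bad by simp
    also have "\<dots> \<le> measure lborel {x \<in> {0<..<1}. x \<notin> \<rat> \<and> S_cf x n k \<ge> (ln (real M) / (8 * exp 1)) ^ k}"
      using measure_S_cf_ge[OF k(1) \<open>k \<le> n\<close>, of M] M(1) unfolding m_def by simp
    also have "\<dots> \<le> measure lborel ?G"
    proof (rule measure_mono_fmeasurable)
      show "{x \<in> {0<..<1}. x \<notin> \<rat> \<and> S_cf x n k \<ge> (ln (real M) / (8 * exp 1)) ^ k} \<in> sets lborel"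
        by measurable
      have unit: "{0<..<1::real} \<in> fmeasurable lborel" by (simp add: fmeasurable_def)
      show "?G \<in> fmeasurable lborel"
      proof (rule fmeasurableI2[OF unit])
        show "?G \<in> sets lborel" by measurable
      qed blast
    qed (use C in \<open>auto simp: m_def\<close>)
    finally show ?thesis .
  qed
  then show ?thesis
    by (intro exI[of _ 1] exI[of _ "1/96"] exI[of _ "max N0 1"]) auto
qed

end
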